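(* Suppose there is a constant $L_\Psi<\infty$ such that $|\Psi(x,y;p)-\Psi(x,y;p')|\le L_\Psi\|p-p'\|$ for all $(x,y)\in X\times Y$ and all data $p,p'\in P$. Let $\{\theta_t\}_{t\ge1}$ satisfy $\theta_t\ge 0$ for all $t\geq 1$ and $\Theta_T:=\sum_{t\in[T]}\theta_t\to\infty$ as $T\to\infty$. Let $\{x_t\}_{t\ge 1}\subseteq X$ and $\{y_t\}_{t\ge1}\subseteq Y$ be sequences. Then, for any fixed $p\in P$ and any sequence $\{p_t\}_{t\ge1}\subseteq P$ with $p_t\to p$, $$\limsup_{T\to\infty}\left[\epsilon^\circ_T+\epsilon^\bullet_T\right]\le\lim_{T\to\infty}\frac{2L_\Psi}{\Theta_T}\sum_{t\in[T]}\theta_t\|p_t-p\|=0,$$ where $$\epsilon^\circ_T := \max_{y\in Y}\frac{1}{\Theta_T}\sum_{t\in[T]}\theta_t\left[\Psi(x_t,y;p)-\Psi(x_t,y;p_t)\right],\qquad \epsilon^\bullet_T := \max_{x\in X}\frac{1}{\Theta_T}\sum_{t\in[T]}\theta_t\left[\Psi(x,y_t;p_t)-\Psi(x,y_t;p)\right].$$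
   Context: $[T]=\{1,\dots,T\}$. $X$ and $Y$ are nonempty convex compact subsets of Euclidean spaces, $P$ is a parameter (data) space contained in a Euclidean space equipped with a fixed norm $\|\cdot\|$, and $\Psi: X\times Y\times P\to\mathbb{R}$, written $\Psi(x,y;p)$, is convex in $x$ and concave in $y$ for every $p\in P$. All maxima written are assumed to be attained (e.g. $\Psi(\cdot,\cdot;p)$ is continuous). The quantities are considered for $T$ large enough that $\Theta_T>0$. *)

theory Defs
  imports "HOL-Analysis.Analysis"
begin

(* The type-class norm of a Euclidean space is the Euclidean one; this predicate
   admits any other norm on the same space. *)
definition is_norm :: "('c::real_vector \<Rightarrow> real) \<Rightarrow> bool" where
  "is_norm N \<longleftrightarrow>
     (\<forall>v. 0 \<le> N v) \<and>
     (\<forall>v. N v = 0 \<longleftrightarrow> v = 0) \<and>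
     (\<forall>a v. N (a *\<^sub>R v) = \<bar>a\<bar> * N v) \<and>
     (\<forall>v w. N (v + w) \<le> N v + N w)"

definition max_attained :: "('a \<Rightarrow> real) \<Rightarrow> 'a set \<Rightarrow> bool" where
  "max_attained f S \<longleftrightarrow> (\<exists>s\<in>S. \<forall>s'\<in>S. f s' \<le> f s)"

(* Greatest element of the image; unspecified unless the maximum is attained. *)
definition max_over :: "('a \<Rightarrow> real) \<Rightarrow> 'a set \<Rightarrow> real" where
  "max_over f S = (GREATEST m. m \<in> f ` S)"

(* Sequences are indexed by t >= 1; their value at index 0 is never used. *)
definition Theta :: "(nat \<Rightarrow> real) \<Rightarrow> nat \<Rightarrow> real" where
  "Theta \<theta> T = (\<Sum>t\<in>{1..T}. \<theta> t)"

definition gap_y ::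
  "('a \<Rightarrow> 'b \<Rightarrow> 'c \<Rightarrow> real) \<Rightarrow> (nat \<Rightarrow> real) \<Rightarrow> (nat \<Rightarrow> 'a) \<Rightarrow> (nat \<Rightarrow> 'c) \<Rightarrow> 'c \<Rightarrow> nat \<Rightarrow> 'b \<Rightarrow> real" where
  "gap_y \<Psi> \<theta> x ps p T y =
     1 / Theta \<theta> T * (\<Sum>t\<in>{1..T}. \<theta> t * (\<Psi> (x t) y p - \<Psi> (x t) y (ps t)))"

definition gap_x ::
  "('a \<Rightarrow> 'b \<Rightarrow> 'c \<Rightarrow> real) \<Rightarrow> (nat \<Rightarrow> real) \<Rightarrow> (nat \<Rightarrow> 'b) \<Rightarrow> (nat \<Rightarrow> 'c) \<Rightarrow> 'c \<Rightarrow> nat \<Rightarrow> 'a \<Rightarrow> real" where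
  "gap_x \<Psi> \<theta> y ps p T x =
     1 / Theta \<theta> T * (\<Sum>t\<in>{1..T}. \<theta> t * (\<Psi> x (y t) (ps t) - \<Psi> x (y t) p))"

definition eps_circ ::
  "'b set \<Rightarrow> ('a \<Rightarrow> 'b \<Rightarrow> 'c \<Rightarrow> real) \<Rightarrow> (nat \<Rightarrow> real) \<Rightarrow> (nat \<Rightarrow> 'a) \<Rightarrow> (nat \<Rightarrow> 'c) \<Rightarrow> 'c \<Rightarrow> nat \<Rightarrow> real" where
  "eps_circ Y \<Psi> \<theta> x ps p T = max_over (gap_y \<Psi> \<theta> x ps p T) Y"

definition eps_bullet ::
  "'a set \<Rightarrow> ('a \<Rightarrow> 'b \<Rightarrow> 'c \<Rightarrow> real) \<Rightarrow> (nat \<Rightarrow> real) \<Rightarrow> (nat \<Rightarrow> 'b) \<Rightarrow> (nat \<Rightarrow> 'c) \<Rightarrow> 'c \<Rightarrow> nat \<Rightarrow> real" where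
  "eps_bullet X \<Psi> \<theta> y ps p T = max_over (gap_x \<Psi> \<theta> y ps p T) X"

end

theory Submission
  imports Defs
begin

text \<open>
  The Lipschitz bound holds uniformly in the decision variables, so every summand of either gap is
  at most \<open>L * N (ps t - p)\<close> times its weight, whichever \<open>x\<close> or \<open>y\<close> is inserted. Hence each of the
  two maxima, being the value at a maximizer, is at most \<open>L\<close> times the weighted average of
  \<open>N (ps t - p)\<close> (lemma \<open>max_over_weighted_mean_le\<close>), which accounts for the factor 2. That average
  tends to zero by Toeplitz's regularity theorem for weighted means with divergent total weight
  (lemma \<open>weighted_mean_tendsto_zero\<close>). Its hypothesis \<open>N (ps t - p) \<longlonglongrightarrow> 0\<close> comes from the fact that
  in finite dimension every norm is dominated by the Euclidean one (lemma \<open>is_norm_le_norm\<close>).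
\<close>

text \<open>
  Expand \<open>v\<close> in the standard basis: each coordinate is at most \<open>norm v\<close> in absolute value, and
  the triangle inequality and homogeneity of \<open>N\<close> do the rest.
\<close>
lemma is_norm_le_norm:
  fixes N :: "'c::euclidean_space \<Rightarrow> real"
  assumes "is_norm N"
  shows "N v \<le> norm v * (\<Sum>b\<in>Basis. N b)"
proof -
  have nonneg: "0 \<le> N w" and zero: "N 0 = 0"
    and scale: "N (a *\<^sub>R w) = \<bar>a\<bar> * N w" and triangle: "N (w + w') \<le> N w + N w'" for a w w'
    using assms by (auto simp: is_norm_def)
  have triangle_sum: "N (\<Sum>i\<in>A. f i) \<le> (\<Sum>i\<in>A. N (f i))" if "finite A" for A and f :: "'c \<Rightarrow> 'c"
    using that
  proof (induction A)
    case (insert i A)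
    then show ?case using triangle[of "f i" "sum f A"] by simp
  qed (simp add: zero)
  have "N v = N (\<Sum>b\<in>Basis. (v \<bullet> b) *\<^sub>R b)"
    by (simp add: euclidean_representation)
  also have "\<dots> \<le> (\<Sum>b\<in>Basis. N ((v \<bullet> b) *\<^sub>R b))"
    by (rule triangle_sum) simp
  also have "\<dots> \<le> (\<Sum>b\<in>Basis. norm v * N b)"
    unfolding scale by (intro sum_mono mult_right_mono Basis_le_norm nonneg)
  finally show ?thesis by (simp add: sum_distrib_left)
qed

lemma is_norm_tendsto_zero:
  fixes N :: "'c::euclidean_space \<Rightarrow> real"
  assumes N: "is_norm N" and lim: "u \<longlonglongrightarrow> l"
  shows "(\<lambda>t. N (u t - l)) \<longlonglongrightarrow> 0"
proof (rule tendsto_sandwich[OF _ _ tendsto_const])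
  show "\<forall>\<^sub>F t in sequentially. 0 \<le> N (u t - l)"
    using N by (simp add: is_norm_def)
  show "\<forall>\<^sub>F t in sequentially. N (u t - l) \<le> norm (u t - l) * (\<Sum>b\<in>Basis. N b)"
    by (simp add: is_norm_le_norm[OF N])
  show "(\<lambda>t. norm (u t - l) * (\<Sum>b\<in>Basis. N b)) \<longlonglongrightarrow> 0"
    using tendsto_mult_left_zero[OF tendsto_norm_zero[OF LIM_zero[OF lim]]] .
qed

text \<open>
  Beyond some index \<open>M\<close> every term is small, so the tail contributes little to the mean whatever the
  weights are; the terms up to \<open>M\<close> add up to a constant, which the diverging total weight drives to
  zero.
\<close>
lemma weighted_mean_tendsto_zero:
  fixes a :: "nat \<Rightarrow> real"
  assumes nonneg: "\<And>t. t \<ge> 1 \<Longrightarrow> \<theta> t \<ge> 0"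
    and at_top: "filterlim (Theta \<theta>) at_top sequentially"
    and lim: "a \<longlonglongrightarrow> 0"
  shows "(\<lambda>T. (\<Sum>t\<in>{1..T}. \<theta> t * a t) / Theta \<theta> T) \<longlonglongrightarrow> 0"
proof (rule LIMSEQ_I)
  fix e :: real assume e: "e > 0"
  obtain M where M: "\<And>t. t \<ge> M \<Longrightarrow> \<bar>a t\<bar> < e / 2"
    using LIMSEQ_D[OF lim, of "e / 2"] e by auto
  define C where "C = (\<Sum>t\<in>{1..M}. \<theta> t * \<bar>a t\<bar>)"
  have C: "0 \<le> C"
    unfolding C_def by (intro sum_nonneg mult_nonneg_nonneg) (auto intro: nonneg)
  \<comment> \<open>A total weight above \<open>2 * C / e\<close> makes the head of the mean smaller than \<open>e / 2\<close>.\<close>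
  have "\<forall>\<^sub>F T in sequentially. M \<le> T \<and> 2 * C / e < Theta \<theta> T"
    using at_top by (intro eventually_conj eventually_ge_at_top) (auto simp: filterlim_at_top_dense)
  then obtain T0 where T0: "\<And>T. T \<ge> T0 \<Longrightarrow> M \<le> T \<and> 2 * C / e < Theta \<theta> T"
    by (auto simp: eventually_sequentially)
  have "norm ((\<Sum>t\<in>{1..T}. \<theta> t * a t) / Theta \<theta> T - 0) < e" if "T \<ge> T0" for T
  proof -
    have MT: "M \<le> T" and Th: "2 * C / e < Theta \<theta> T"
      using T0[OF that] by auto
    have pos: "0 < Theta \<theta> T"
      using Th C e by (smt (verit) divide_nonneg_pos)
    have split: "{1..T} = {1..M} \<union> {M<..T}"
      using MT by auto
    have "\<bar>\<Sum>t\<in>{1..T}. \<theta> t * a t\<bar> \<le> (\<Sum>t\<in>{1..T}. \<bar>\<theta> t * a t\<bar>)"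
      by (rule sum_abs)
    also have "\<dots> = (\<Sum>t\<in>{1..T}. \<theta> t * \<bar>a t\<bar>)"
      by (intro sum.cong refl) (simp add: abs_mult nonneg)
    also have "\<dots> = C + (\<Sum>t\<in>{M<..T}. \<theta> t * \<bar>a t\<bar>)"
      unfolding C_def split by (rule sum.union_disjoint) auto
    also have "\<dots> \<le> C + (\<Sum>t\<in>{M<..T}. \<theta> t * (e / 2))"
      using M by (intro add_left_mono sum_mono mult_left_mono nonneg) (auto intro: less_imp_le)
    also have "\<dots> \<le> C + (\<Sum>t\<in>{1..T}. \<theta> t * (e / 2))"
      using e by (intro add_left_mono sum_mono2 mult_nonneg_nonneg nonneg) auto
    also have "\<dots> = C + Theta \<theta> T * (e / 2)"
      by (simp add: Theta_def sum_distrib_right)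
    also have "\<dots> < e * Theta \<theta> T"
      using Th e by (simp add: field_simps)
    finally show ?thesis
      using pos by (simp add: field_simps)
  qed
  then show "\<exists>T0. \<forall>T\<ge>T0. norm ((\<Sum>t\<in>{1..T}. \<theta> t * a t) / Theta \<theta> T - 0) < e"
    by blast
qed

lemma max_over_le:
  assumes "max_attained f S" and bound: "\<And>s. s \<in> S \<Longrightarrow> f s \<le> B"
  shows "max_over f S \<le> B"
proof -
  obtain s where s: "s \<in> S" "\<And>s'. s' \<in> S \<Longrightarrow> f s' \<le> f s"
    using assms(1) by (auto simp: max_attained_def)
  have "max_over f S = f s"
    unfolding max_over_def using s by (intro Greatest_equality) auto
  with bound[OF s(1)] show ?thesis by simp
qed

text \<open>
  Both error terms are maxima of weighted means of perturbations \<open>d s t\<close>, and a bound on \<open>d s t\<close>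
  that is uniform in \<open>s\<close> passes to the maximum of the means.
\<close>
lemma max_over_weighted_mean_le:
  assumes att: "max_attained (\<lambda>s. 1 / Theta \<theta> T * (\<Sum>t\<in>{1..T}. \<theta> t * d s t)) S"
    and nonneg: "\<And>t. t \<ge> 1 \<Longrightarrow> \<theta> t \<ge> 0"
    and pos: "Theta \<theta> T > 0"
    and bound: "\<And>s t. s \<in> S \<Longrightarrow> t \<ge> 1 \<Longrightarrow> d s t \<le> L * a t"
  shows "max_over (\<lambda>s. 1 / Theta \<theta> T * (\<Sum>t\<in>{1..T}. \<theta> t * d s t)) S
           \<le> L / Theta \<theta> T * (\<Sum>t\<in>{1..T}. \<theta> t * a t)"
proof (rule max_over_le[OF att])
  fix s assume "s \<in> S"
  then have "(\<Sum>t\<in>{1..T}. \<theta> t * d s t) \<le> (\<Sum>t\<in>{1..T}. \<theta> t * (L * a t))"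
    by (intro sum_mono mult_left_mono bound nonneg) auto
  also have "\<dots> = L * (\<Sum>t\<in>{1..T}. \<theta> t * a t)"
    by (simp add: sum_distrib_left mult.left_commute)
  finally show "1 / Theta \<theta> T * (\<Sum>t\<in>{1..T}. \<theta> t * d s t)
                  \<le> L / Theta \<theta> T * (\<Sum>t\<in>{1..T}. \<theta> t * a t)"
    using pos by (simp add: divide_right_mono)
qed

theorem theorem2:
  fixes X :: "'a::euclidean_space set"
    and Y :: "'b::euclidean_space set"
    and P :: "'c::euclidean_space set"
    and N :: "'c \<Rightarrow> real"
    and \<Psi> :: "'a \<Rightarrow> 'b \<Rightarrow> 'c \<Rightarrow> real"
    and L :: real
    and \<theta> :: "nat \<Rightarrow> real"
    and x :: "nat \<Rightarrow> 'a"
    and y :: "nat \<Rightarrow> 'b"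
    and p :: 'c
    and ps :: "nat \<Rightarrow> 'c"
  assumes X: "X \<noteq> {}" "convex X" "compact X"
    and Y: "Y \<noteq> {}" "convex Y" "compact Y"
    and N: "is_norm N"
    and Psi_convex: "\<And>y p. y \<in> Y \<Longrightarrow> p \<in> P \<Longrightarrow> convex_on X (\<lambda>x. \<Psi> x y p)"
    and Psi_concave: "\<And>x p. x \<in> X \<Longrightarrow> p \<in> P \<Longrightarrow> concave_on Y (\<lambda>y. \<Psi> x y p)"
    and Psi_Lipschitz: "\<And>x y p p'. x \<in> X \<Longrightarrow> y \<in> Y \<Longrightarrow> p \<in> P \<Longrightarrow> p' \<in> P \<Longrightarrow>
          \<bar>\<Psi> x y p - \<Psi> x y p'\<bar> \<le> L * N (p - p')"
    and theta_nonneg: "\<And>t. t \<ge> 1 \<Longrightarrow> \<theta> t \<ge> 0"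
    and Theta_at_top: "filterlim (Theta \<theta>) at_top sequentially"
    and x_mem: "\<And>t. t \<ge> 1 \<Longrightarrow> x t \<in> X"
    and y_mem: "\<And>t. t \<ge> 1 \<Longrightarrow> y t \<in> Y"
    and p_mem: "p \<in> P"
    and ps_mem: "\<And>t. t \<ge> 1 \<Longrightarrow> ps t \<in> P"
    and ps_lim: "ps \<longlonglongrightarrow> p"
    and max_y: "\<And>T. Theta \<theta> T > 0 \<Longrightarrow> max_attained (gap_y \<Psi> \<theta> x ps p T) Y"
    and max_x: "\<And>T. Theta \<theta> T > 0 \<Longrightarrow> max_attained (gap_x \<Psi> \<theta> y ps p T) X"
  shows "limsup (\<lambda>T. ereal (eps_circ Y \<Psi> \<theta> x ps p T + eps_bullet X \<Psi> \<theta> y ps p T))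
           \<le> ereal (lim (\<lambda>T. 2 * L / Theta \<theta> T * (\<Sum>t\<in>{1..T}. \<theta> t * N (ps t - p))))
         \<and> (\<lambda>T. 2 * L / Theta \<theta> T * (\<Sum>t\<in>{1..T}. \<theta> t * N (ps t - p))) \<longlonglongrightarrow> 0"
proof -
  let ?a = "\<lambda>t. N (ps t - p)"
  let ?b = "\<lambda>T. 2 * L / Theta \<theta> T * (\<Sum>t\<in>{1..T}. \<theta> t * ?a t)"
  have "(\<lambda>T. 2 * L * ((\<Sum>t\<in>{1..T}. \<theta> t * ?a t) / Theta \<theta> T)) \<longlonglongrightarrow> 2 * L * 0"
    by (intro tendsto_mult tendsto_const
        weighted_mean_tendsto_zero[OF theta_nonneg Theta_at_top is_norm_tendsto_zero[OF N ps_lim]])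
  then have b_lim: "?b \<longlonglongrightarrow> 0"
    by simp
  have bound: "eps_circ Y \<Psi> \<theta> x ps p T + eps_bullet X \<Psi> \<theta> y ps p T \<le> ?b T"
    if pos: "Theta \<theta> T > 0" for T
  proof -
    have gap_y: "gap_y \<Psi> \<theta> x ps p T =
        (\<lambda>v. 1 / Theta \<theta> T * (\<Sum>t\<in>{1..T}. \<theta> t * (\<Psi> (x t) v p - \<Psi> (x t) v (ps t))))"
      by (simp add: gap_y_def fun_eq_iff)
    have gap_x: "gap_x \<Psi> \<theta> y ps p T =
        (\<lambda>u. 1 / Theta \<theta> T * (\<Sum>t\<in>{1..T}. \<theta> t * (\<Psi> u (y t) (ps t) - \<Psi> u (y t) p)))"
      by (simp add: gap_x_def fun_eq_iff)
    have y_le: "\<Psi> (x t) v p - \<Psi> (x t) v (ps t) \<le> L * ?a t" if "v \<in> Y" "t \<ge> 1" for v t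
      using Psi_Lipschitz[OF x_mem[OF that(2)] that(1) ps_mem[OF that(2)] p_mem] by linarith
    have x_le: "\<Psi> u (y t) (ps t) - \<Psi> u (y t) p \<le> L * ?a t" if "u \<in> X" "t \<ge> 1" for u t
      using Psi_Lipschitz[OF that(1) y_mem[OF that(2)] ps_mem[OF that(2)] p_mem] by linarith
    have "eps_circ Y \<Psi> \<theta> x ps p T \<le> L / Theta \<theta> T * (\<Sum>t\<in>{1..T}. \<theta> t * ?a t)"
      unfolding eps_circ_def gap_y
      by (rule max_over_weighted_mean_le[OF max_y[OF pos, unfolded gap_y] theta_nonneg pos y_le])
    moreover have "eps_bullet X \<Psi> \<theta> y ps p T \<le> L / Theta \<theta> T * (\<Sum>t\<in>{1..T}. \<theta> t * ?a t)"
      unfolding eps_bullet_def gap_x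
      by (rule max_over_weighted_mean_le[OF max_x[OF pos, unfolded gap_x] theta_nonneg pos x_le])
    ultimately show ?thesis
      by simp
  qed
  have "\<forall>\<^sub>F T in sequentially. Theta \<theta> T > 0"
    using Theta_at_top by (simp add: filterlim_at_top_dense)
  then have "\<forall>\<^sub>F T in sequentially.
      ereal (eps_circ Y \<Psi> \<theta> x ps p T + eps_bullet X \<Psi> \<theta> y ps p T) \<le> ereal (?b T)"
    by eventually_elim (simp only: ereal_less_eq bound)
  then have "limsup (\<lambda>T. ereal (eps_circ Y \<Psi> \<theta> x ps p T + eps_bullet X \<Psi> \<theta> y ps p T))
      \<le> limsup (\<lambda>T. ereal (?b T))"
    by (rule Limsup_mono)
  also have "\<dots> = ereal (lim ?b)"
    using b_lim by (intro lim_imp_Limsup) (simp_all only: limI[OF b_lim] lim_ereal trivial_limit_sequentially not_False_eq_True)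
  finally show ?thesis
    using b_lim by blast
qed

end
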